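(* Let $R\subseteq S$ be an FCP distributive extension of commutative rings and set $n:=\ell[R,S]$. Then the following conditions are equivalent: (1) $R\subseteq S$ is a Boolean extension. (2) $n=|\mathcal A|$, where $\mathcal A$ is the set of atoms of $[R,S]$. (3) $|[R,S]|=2^n$. If these conditions hold, then $R\subseteq S$ has FIP, is factorial and is a simple pair. Moreover, for each $T,U\in[R,S]$ with $T\subseteq U$, all maximal chains of $[T,U]$ have the same length.
   Context: Rings are commutative with unit. For a ring extension $R\subseteq S$, $[R,S]$ is the set of all $R$-subalgebras of $S$, a complete lattice under inclusion, with infimum the intersection and supremum (called product) the compositum. The extension has FIP if $[R,S]$ is finite, and FCP if each chain in $[R,S]$ is finite. $\ell[R,S]$ is the supremum of the lengths of chains in $[R,S]$ (a chain $R_0\subset R_1\subset\cdots\subset R_m$ has length $m$). An atom of $[R,S]$ is a $T\in[R,S]$ with $R\ne T$ and $[R,T]=\{R,T\}$. The extension is distributive if intersection and product are distributive with respect to each other in $[R,S]$; it is Boolean if it is distributive and each $T\in[R,S]$ has a complement, i.e. some $T'\in[R,S]$ with $T\cap T'=R$ and $TT'=S$. It is factorial if each element of $[R,S]$ has a unique irredundant representation as a finite product of atoms (the empty product being $R$). It is a simple pair if for every $T\in[R,S]$ there is $t\in T$ with $T=R[t]$. *)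

theory Defs
  imports "HOL-Algebra.Algebra" "HOL-Library.Extended_Nat"
begin

text \<open>
  A ring extension is given by a commutative ring \<open>S\<close> and a subring \<open>R\<close> of \<open>S\<close>, so that an
  \<open>R\<close>-subalgebra of \<open>S\<close> is a subring of \<open>S\<close> that contains \<open>R\<close>.  All rings between \<open>R\<close> and \<open>S\<close>
  are represented by their carriers.  Below, \<open>interval S T U\<close> is $[T,U]$ for subrings
  \<open>T \<subseteq> U\<close> of \<open>S\<close>; in particular $[R,S]$ is \<open>interval S R (carrier S)\<close>.
\<close>

definition interval :: "('a, 'b) ring_scheme \<Rightarrow> 'a set \<Rightarrow> 'a set \<Rightarrow> 'a set set" where
  "interval S T U = {V. subring V S \<and> T \<subseteq> V \<and> V \<subseteq> U}"

abbreviation extensions :: "('a, 'b) ring_scheme \<Rightarrow> 'a set \<Rightarrow> 'a set set" where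
  "extensions S R \<equiv> interval S R (carrier S)"

definition compositum :: "('a, 'b) ring_scheme \<Rightarrow> 'a set \<Rightarrow> 'a set \<Rightarrow> 'a set" where
  "compositum S T U = generate_ring S (T \<union> U)"

text \<open>The union with \<open>R\<close> only matters for the empty family, whose product is \<open>R\<close>.\<close>

definition family_product :: "('a, 'b) ring_scheme \<Rightarrow> 'a set \<Rightarrow> 'a set set \<Rightarrow> 'a set" where
  "family_product S R F = generate_ring S (R \<union> \<Union>F)"

definition has_FIP :: "('a, 'b) ring_scheme \<Rightarrow> 'a set \<Rightarrow> bool" where
  "has_FIP S R \<longleftrightarrow> finite (extensions S R)"

definition has_FCP :: "('a, 'b) ring_scheme \<Rightarrow> 'a set \<Rightarrow> bool" where
  "has_FCP S R \<longleftrightarrow> (\<forall>C. subset.chain (extensions S R) C \<longrightarrow> finite C)"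

text \<open>A chain with \<open>m + 1\<close> members has length \<open>m\<close>; this is meant for nonempty chains.\<close>

definition chain_length :: "'a set set \<Rightarrow> enat" where
  "chain_length C = (if finite C then enat (card C - 1) else \<infinity>)"

definition ext_length :: "('a, 'b) ring_scheme \<Rightarrow> 'a set \<Rightarrow> enat" where
  "ext_length S R = (SUP C \<in> {C. subset.chain (extensions S R) C \<and> C \<noteq> {}}. chain_length C)"

definition atoms :: "('a, 'b) ring_scheme \<Rightarrow> 'a set \<Rightarrow> 'a set set" where
  "atoms S R = {T \<in> extensions S R. R \<noteq> T \<and> interval S R T = {R, T}}"

definition distributive_ext :: "('a, 'b) ring_scheme \<Rightarrow> 'a set \<Rightarrow> bool" where
  "distributive_ext S R \<longleftrightarrow>
     (\<forall>T \<in> extensions S R. \<forall>U \<in> extensions S R. \<forall>V \<in> extensions S R.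
        T \<inter> compositum S U V = compositum S (T \<inter> U) (T \<inter> V) \<and>
        compositum S T (U \<inter> V) = compositum S T U \<inter> compositum S T V)"

definition boolean_ext :: "('a, 'b) ring_scheme \<Rightarrow> 'a set \<Rightarrow> bool" where
  "boolean_ext S R \<longleftrightarrow> distributive_ext S R \<and>
     (\<forall>T \<in> extensions S R. \<exists>T' \<in> extensions S R. T \<inter> T' = R \<and> compositum S T T' = carrier S)"

text \<open>
  In an irredundant product no factor can be omitted.  Such a product has no repeated factors and
  the order of the factors is irrelevant, so a representation is a finite set of atoms.
\<close>

definition irredundant_rep ::
    "('a, 'b) ring_scheme \<Rightarrow> 'a set \<Rightarrow> 'a set \<Rightarrow> 'a set set \<Rightarrow> bool" where
  "irredundant_rep S R T F \<longleftrightarrow> finite F \<and> F \<subseteq> atoms S R \<and> family_product S R F = T \<and>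
     (\<forall>A \<in> F. family_product S R (F - {A}) \<noteq> T)"

definition factorial_ext :: "('a, 'b) ring_scheme \<Rightarrow> 'a set \<Rightarrow> bool" where
  "factorial_ext S R \<longleftrightarrow> (\<forall>T \<in> extensions S R. \<exists>!F. irredundant_rep S R T F)"

text \<open>\<open>ring.simple_extension S R t\<close> is $R[t]$, the set of polynomial expressions in \<open>t\<close> over \<open>R\<close>.\<close>

definition simple_pair :: "('a, 'b) ring_scheme \<Rightarrow> 'a set \<Rightarrow> bool" where
  "simple_pair S R \<longleftrightarrow> (\<forall>T \<in> extensions S R. \<exists>t \<in> T. T = ring.simple_extension S R t)"

end

theory Submission
  imports Defs
begin

text \<open>
  Call \<open>P \<noteq> R\<close> in $[R,S]$ prime if \<open>P \<subseteq> UV\<close> implies \<open>P \<subseteq> U\<close> or \<open>P \<subseteq> V\<close>.  By the descending chain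
  condition and distributivity, whenever \<open>W\<close> is not contained in \<open>Y\<close> there is a prime contained in
  \<open>W\<close> but not in \<open>Y\<close>; so an element is determined by the set of primes below it.  Along a maximal
  chain of $[T,U]$, every step adds exactly one prime, so its length is the number of primes
  contained in \<open>U\<close> but not in \<open>T\<close>.  In particular there are \<open>n\<close> primes, and $[R,S]$ embeds into the
  power set of the set of primes.  Atoms are prime, and each of the conditions (1)--(3) says that
  all primes are atoms.  In that case, if \<open>T\<close> is the product of the atoms \<open>A\<^sub>i\<close> and \<open>x\<^sub>i\<close> is
  in \<open>A\<^sub>i\<close> but not in \<open>R\<close>, then \<open>t = \<Sum>\<^sub>i x\<^sub>i\<close> generates \<open>T\<close>: the ring
  $R[t]$ omits no \<open>A\<^sub>j\<close>, since otherwise it would be contained in the product of the \<open>A\<^sub>i\<close> with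
  \<open>i \<noteq> j\<close>, which contains \<open>x\<^sub>i\<close> for \<open>i \<noteq> j\<close> but not \<open>x\<^sub>j\<close>.
\<close>

section \<open>Distributive lattices of sets with finite chains\<close>

text \<open>Isolates the order-theoretic part of the argument. Meets are plain intersections, but
  the join \<open>lub\<close> is only characterised as a least upper bound, since a compositum is in
  general larger than a union.\<close>

locale distributive_fcp_lattice =
  fixes L :: "'a set set" and bt tp :: "'a set" and lub :: "'a set set \<Rightarrow> 'a set"
  assumes bt_in: "bt \<in> L" and bt_le: "W \<in> L \<Longrightarrow> bt \<subseteq> W"
    and tp_in: "tp \<in> L" and le_tp: "W \<in> L \<Longrightarrow> W \<subseteq> tp"
    and inter_in: "W \<in> L \<Longrightarrow> Y \<in> L \<Longrightarrow> W \<inter> Y \<in> L"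
    and lub_in: "F \<subseteq> L \<Longrightarrow> lub F \<in> L"
    and lub_upper: "F \<subseteq> L \<Longrightarrow> W \<in> F \<Longrightarrow> W \<subseteq> lub F"
    and lub_least: "F \<subseteq> L \<Longrightarrow> Y \<in> L \<Longrightarrow> (\<And>W. W \<in> F \<Longrightarrow> W \<subseteq> Y) \<Longrightarrow> lub F \<subseteq> Y"
    and inter_lub: "W \<in> L \<Longrightarrow> U \<in> L \<Longrightarrow> V \<in> L \<Longrightarrow> W \<inter> lub {U, V} = lub {W \<inter> U, W \<inter> V}"
    and finite_chain: "subset.chain L C \<Longrightarrow> finite C"
begin

definition primes :: "'a set set" where
  "primes = {P \<in> L. P \<noteq> bt \<and> (\<forall>U\<in>L. \<forall>V\<in>L. P \<subseteq> lub {U, V} \<longrightarrow> P \<subseteq> U \<or> P \<subseteq> V)}"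

definition minimals :: "'a set set" where
  "minimals = {A \<in> L. A \<noteq> bt \<and> (\<forall>W\<in>L. W \<subseteq> A \<longrightarrow> W = bt \<or> W = A)}"

text \<open>This is the Birkhoff representation of an element by a set of primes: an order embedding
  in general, and onto all sets of primes exactly in the Boolean case.\<close>

definition below :: "'a set \<Rightarrow> 'a set set" where
  "below W = {P \<in> primes. P \<subseteq> W}"

definition complemented :: bool where
  "complemented \<longleftrightarrow> (\<forall>W\<in>L. \<exists>Y\<in>L. W \<inter> Y = bt \<and> lub {W, Y} = tp)"

section \<open>Separating elements by primes\<close>

lemma primes_in: "P \<in> primes \<Longrightarrow> P \<in> L"
  by (simp add: primes_def)

lemma minimals_in: "A \<in> minimals \<Longrightarrow> A \<in> L"
  by (simp add: minimals_def)

lemma prime_not_le_bt: "P \<in> primes \<Longrightarrow> \<not> P \<subseteq> bt"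
  using bt_le by (fastforce simp: primes_def)

lemma prime_le_lub2: "P \<in> primes \<Longrightarrow> U \<in> L \<Longrightarrow> V \<in> L \<Longrightarrow> P \<subseteq> lub {U, V} \<Longrightarrow> P \<subseteq> U \<or> P \<subseteq> V"
  by (auto simp: primes_def)

text \<open>A maximal chain of \<open>M\<close> is finite and nonempty, so its intersection is its
  least member. An element of \<open>M\<close> below that member could be added to the chain, hence
  already belongs to it.\<close>

lemma ex_minimal:
  assumes "M \<subseteq> L" "M \<noteq> {}"
  shows "\<exists>m\<in>M. \<forall>x\<in>M. x \<subseteq> m \<longrightarrow> x = m"
proof -
  obtain C where C: "subset.maxchain M C"
    using subset.Hausdorff by blast
  then have ch: "subset.chain M C"
    by (rule pred_on.maxchain_imp_chain)
  then have "subset.chain L C"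
    using assms(1) by (auto simp: subset_chain_def)
  then have fin: "finite C"
    by (rule finite_chain)
  have ext: "x \<in> C" if "x \<in> M" "\<forall>c\<in>C. x \<subseteq> c" for x
  proof (rule ccontr)
    assume "x \<notin> C"
    moreover have "subset.chain M (insert x C)"
      using ch that by (auto simp: subset_chain_def)
    ultimately show False
      using C unfolding pred_on.maxchain_def by blast
  qed
  have "C \<noteq> {}"
    using ext assms(2) by auto
  then have I: "\<Inter>C \<in> C"
    using Inter_in_chain[OF fin _ ch] by blast
  show ?thesis
  proof (intro bexI ballI impI)
    show "\<Inter>C \<in> M"
      using I ch by (auto simp: subset_chain_def)
    fix x assume "x \<in> M" "x \<subseteq> \<Inter>C"
    then show "x = \<Inter>C"
      using ext[of x] by blast
  qed
qed

text \<open>Take \<open>P\<close> minimal among the elements inside \<open>W\<close> but not inside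
  \<open>Y\<close>. If \<open>P\<close> lay in a join of \<open>U\<close> and \<open>V\<close> but
  in neither of them, distributivity would make \<open>P\<close> the join of two smaller elements,
  both inside \<open>Y\<close> by minimality.\<close>

lemma ex_prime:
  assumes W: "W \<in> L" and Y: "Y \<in> L" and "\<not> W \<subseteq> Y"
  shows "\<exists>P\<in>primes. P \<subseteq> W \<and> \<not> P \<subseteq> Y"
proof -
  define M where "M = {Z \<in> L. Z \<subseteq> W \<and> \<not> Z \<subseteq> Y}"
  have "M \<subseteq> L" "M \<noteq> {}"
    using assms by (auto simp: M_def)
  then obtain P where P: "P \<in> M" and min: "\<And>Z. Z \<in> M \<Longrightarrow> Z \<subseteq> P \<Longrightarrow> Z = P"
    using ex_minimal by meson
  have PL: "P \<in> L" "P \<subseteq> W" "\<not> P \<subseteq> Y"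
    using P by (auto simp: M_def)
  have "P \<subseteq> U \<or> P \<subseteq> V" if UV: "U \<in> L" "V \<in> L" "P \<subseteq> lub {U, V}" for U V
  proof (rule ccontr)
    assume neg: "\<not> (P \<subseteq> U \<or> P \<subseteq> V)"
    \<comment> \<open>\<open>P \<inter> Z\<close> is properly smaller than \<open>P\<close> and
      still inside \<open>W\<close>, so minimality leaves only failure of the other condition in
      \<open>M\<close>.\<close>
    have *: "P \<inter> Z \<subseteq> Y" if "Z \<in> L" "\<not> P \<subseteq> Z" for Z
      using min[of "P \<inter> Z"] that PL inter_in[of P Z] by (auto simp: M_def)
    have "P = lub {P \<inter> U, P \<inter> V}"
      using inter_lub[OF PL(1) UV(1,2)] UV(3) by blast
    also have "\<dots> \<subseteq> Y"
      using * UV neg Y PL by (intro lub_least) (auto simp: inter_in)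
    finally show False
      using PL by simp
  qed
  then have "P \<in> primes"
    using PL bt_le[OF Y] by (auto simp: primes_def)
  then show ?thesis
    using PL by blast
qed

lemma below_mono: "W \<subseteq> Y \<Longrightarrow> below W \<subseteq> below Y"
  by (auto simp: below_def)

lemma below_subset_iff: "W \<in> L \<Longrightarrow> Y \<in> L \<Longrightarrow> below W \<subseteq> below Y \<longleftrightarrow> W \<subseteq> Y"
  using ex_prime[of W Y] by (auto simp: below_def)

lemma inj_on_below: "inj_on below L"
  by (intro inj_onI) (metis below_subset_iff order_refl subset_antisym)

text \<open>Iterates the binary property. The induction starts because the empty join is
  \<open>bt\<close>, which contains no prime.\<close>

lemma prime_le_lub:
  assumes P: "P \<in> primes" and F: "finite F" "F \<subseteq> L" and "P \<subseteq> lub F"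
  shows "\<exists>W\<in>F. P \<subseteq> W"
  using F \<open>P \<subseteq> lub F\<close>
proof (induction F rule: finite_induct)
  case empty
  have "lub {} \<subseteq> bt"
    using bt_in by (intro lub_least) auto
  then show ?case
    using prime_not_le_bt[OF P] empty by auto
next
  case (insert W F)
  then have WF: "W \<in> L" "F \<subseteq> L" "lub F \<in> L"
    using lub_in by auto
  then have in2: "lub {W, lub F} \<in> L"
    by (intro lub_in) auto
  have "lub (insert W F) \<subseteq> lub {W, lub F}"
  proof (intro lub_least)
    fix Z assume "Z \<in> insert W F"
    then show "Z \<subseteq> lub {W, lub F}"
      using WF lub_upper[of "{W, lub F}"] lub_upper[of F Z] by blast
  qed (use WF in2 in auto)
  then have "P \<subseteq> W \<or> P \<subseteq> lub F"
    using insert.prems WF by (intro prime_le_lub2[OF P]) auto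
  then show ?case
    using insert WF by auto
qed

section \<open>Maximal chains and the length\<close>

text \<open>Each prime is sent to the member of \<open>C\<close> at which it first appears. Every
  step of the chain adds a prime by \<open>ex_prime\<close>, and by maximality of \<open>C\<close>
  it adds only one.\<close>

lemma bij_betw_maxchain:
  assumes T: "T \<in> L" and U: "U \<in> L" and TU: "T \<subseteq> U"
    and C: "subset.maxchain {V \<in> L. T \<subseteq> V \<and> V \<subseteq> U} C"
  shows "bij_betw (\<lambda>P. \<Inter>{c \<in> C. P \<subseteq> c}) {P \<in> primes. P \<subseteq> U \<and> \<not> P \<subseteq> T} (C - {T})"
    and "finite C" and "T \<in> C"
proof -
  let ?I = "{V \<in> L. T \<subseteq> V \<and> V \<subseteq> U}"
  define f where "f = (\<lambda>P. \<Inter>{c \<in> C. P \<subseteq> c})"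
  let ?Q = "{P \<in> primes. P \<subseteq> U \<and> \<not> P \<subseteq> T}"
  have ch: "subset.chain ?I C"
    using C by (rule pred_on.maxchain_imp_chain)
  have CI: "C \<subseteq> ?I" and tot: "\<And>x y. x \<in> C \<Longrightarrow> y \<in> C \<Longrightarrow> x \<subseteq> y \<or> y \<subseteq> x"
    using ch by (auto simp: subset_chain_def)
  have sub: "subset.chain L D" if D: "D \<subseteq> C" for D
    unfolding subset_chain_def
  proof (intro conjI ballI)
    show "D \<subseteq> L"
      using D CI by auto
    show "x \<subseteq> y \<or> y \<subseteq> x" if "x \<in> D" "y \<in> D" for x y
      using D that by (intro tot) auto
  qed
  show fin: "finite C"
    using finite_chain sub by blast
  have ext: "x \<in> C" if "x \<in> ?I" "\<forall>c\<in>C. x \<subseteq> c \<or> c \<subseteq> x" for x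
  proof (rule ccontr)
    assume "x \<notin> C"
    moreover have "subset.chain ?I (insert x C)"
      using ch that unfolding subset_chain_def by auto
    ultimately show False
      using C unfolding pred_on.maxchain_def by blast
  qed
  show TC: "T \<in> C"
    using CI T TU by (intro ext) auto
  have UC: "U \<in> C"
    using CI U TU by (intro ext) auto
  have fC: "f P \<in> C" if "P \<subseteq> U" for P
  proof -
    have "f P \<in> {c \<in> C. P \<subseteq> c}"
      unfolding f_def
    proof (rule Inter_in_chain)
      show "subset.chain L {c \<in> C. P \<subseteq> c}"
        by (rule sub) auto
    qed (use fin UC that in auto)
    then show ?thesis
      by simp
  qed
  have le_f: "P \<subseteq> f P" for P
    unfolding f_def by blast
  have f_le: "f P \<subseteq> c" if "c \<in> C" "P \<subseteq> c" for P c
    using that unfolding f_def by blast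
  \<comment> \<open>Every member other than \<open>T\<close> has an immediate predecessor in
    \<open>C\<close>: the union of the finitely many smaller members, which include
    \<open>T\<close>.\<close>
  have pred: "\<exists>b\<in>C. b \<subset> c \<and> (\<forall>d\<in>C. d \<subset> c \<longrightarrow> d \<subseteq> b)" if "c \<in> C" "c \<noteq> T" for c
  proof -
    let ?D = "{d \<in> C. d \<subset> c}"
    have "T \<in> ?D"
      using that TC CI by auto
    have "\<Union>?D \<in> ?D"
    proof (rule Union_in_chain)
      show "?D \<noteq> {}"
        using \<open>T \<in> ?D\<close> by blast
      show "subset.chain L ?D"
        by (rule sub) auto
    qed (use fin in auto)
    then show ?thesis
      by blast
  qed
  \<comment> \<open>If \<open>P\<close> and \<open>Q\<close> first appear at the same member, with
    predecessor \<open>b\<close>, then the join of \<open>b\<close> and \<open>P\<close> must be all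
    of that member. It thus contains \<open>Q\<close>, and primality together with \<open>Q\<close>
    not inside \<open>b\<close> forces \<open>Q\<close> inside \<open>P\<close>.\<close>
  have same: "Q \<subseteq> P" if "P \<in> ?Q" "Q \<in> ?Q" "f P = f Q" for P Q
  proof -
    have cC: "f P \<in> C" and "f P \<noteq> T"
      using fC[of P] le_f[of P] that(1) by auto
    then obtain b where b: "b \<in> C" "b \<subset> f P" "\<And>d. d \<in> C \<Longrightarrow> d \<subset> f P \<Longrightarrow> d \<subseteq> b"
      using pred by meson
    have nP: "\<not> P \<subseteq> b"
      using f_le[OF b(1)] b(2) by (meson psubsetE)
    have "b \<subset> f Q"
      using b(2) by (simp only: that(3))
    then have nQ: "\<not> Q \<subseteq> b"
      using f_le[OF b(1)] by (meson psubsetE)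
    have bL: "b \<in> L" "T \<subseteq> b" and cL: "f P \<in> L" "f P \<subseteq> U" and PL: "P \<in> L"
      using b(1) cC CI that(1) primes_in by auto
    let ?v = "lub {b, P}"
    have v: "?v \<in> L" "b \<subseteq> ?v" "P \<subseteq> ?v"
      using lub_in lub_upper[of "{b, P}"] bL PL by auto
    have vc: "?v \<subseteq> f P"
      using bL PL b(2) le_f[of P] by (intro lub_least cL) auto
    \<comment> \<open>No member of \<open>C\<close> lies strictly between \<open>b\<close> and
      \<open>f P\<close>, so \<open>?v\<close> is comparable with every member and maximality
      applies.\<close>
    have "?v \<in> C"
    proof (rule ext)
      show "?v \<in> ?I"
        using v bL vc cL by auto
      show "\<forall>d\<in>C. ?v \<subseteq> d \<or> d \<subseteq> ?v"
      proof
        fix d assume "d \<in> C"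
        then consider "f P \<subseteq> d" | "d \<subset> f P"
          using tot[OF cC] by blast
        then show "?v \<subseteq> d \<or> d \<subseteq> ?v"
          using b(3)[OF \<open>d \<in> C\<close>] v vc by cases blast+
      qed
    qed
    then have "f P \<subseteq> ?v"
      by (rule f_le[OF _ v(3)])
    then have "Q \<subseteq> ?v"
      using le_f[of Q] that(3) by simp
    then show ?thesis
      using prime_le_lub2[of Q b P] that(2) nQ bL PL by auto
  qed
  have "bij_betw f ?Q (C - {T})"
  proof (rule bij_betwI')
    fix P Q assume "P \<in> ?Q" "Q \<in> ?Q"
    then show "f P = f Q \<longleftrightarrow> P = Q"
      using same[of P Q] same[of Q P] by blast
  next
    fix P assume "P \<in> ?Q"
    then show "f P \<in> C - {T}"
      using fC[of P] le_f[of P] by auto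
  next
    fix c assume c: "c \<in> C - {T}"
    then have "c \<in> C" "c \<noteq> T"
      by auto
    then obtain b where b: "b \<in> C" "b \<subset> c" "\<And>d. d \<in> C \<Longrightarrow> d \<subset> c \<Longrightarrow> d \<subseteq> b"
      using pred by meson
    have "c \<in> L" "b \<in> L" "T \<subseteq> b" "c \<subseteq> U"
      using c b CI by auto
    then obtain P where P: "P \<in> primes" "P \<subseteq> c" "\<not> P \<subseteq> b"
      using ex_prime[of c b] b(2) by auto
    have PQ: "P \<in> ?Q"
      using P \<open>T \<subseteq> b\<close> \<open>c \<subseteq> U\<close> by auto
    have "f P \<subseteq> c"
      using c P(2) by (intro f_le) auto
    \<comment> \<open>Were \<open>P\<close> to appear before \<open>c\<close>, it would already be
      inside the predecessor \<open>b\<close>.\<close>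
    moreover have "\<not> f P \<subset> c"
    proof
      assume "f P \<subset> c"
      moreover have "f P \<in> C"
        using PQ by (intro fC) simp
      ultimately have "f P \<subseteq> b"
        using b(3) by blast
      then show False
        using le_f[of P] P(3) by (meson subset_trans)
    qed
    ultimately show "\<exists>P\<in>?Q. c = f P"
      using PQ by (intro bexI[of _ P]) (auto simp only: psubset_eq)
  qed
  then show "bij_betw (\<lambda>P. \<Inter>{c \<in> C. P \<subseteq> c}) ?Q (C - {T})"
    unfolding f_def .
qed

text \<open>The successor accounts for the bottom member \<open>T\<close>, at which none of the
  counted primes appears.\<close>

lemma card_maxchain:
  assumes "T \<in> L" "U \<in> L" "T \<subseteq> U" "subset.maxchain {V \<in> L. T \<subseteq> V \<and> V \<subseteq> U} C"
  shows "card C = Suc (card {P \<in> primes. P \<subseteq> U \<and> \<not> P \<subseteq> T})"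
  using card_Suc_Diff1[OF bij_betw_maxchain(2,3)[OF assms]]
  unfolding bij_betw_same_card[OF bij_betw_maxchain(1)[OF assms]] by (rule sym)

text \<open>The case of the whole lattice, where all primes are counted; their finiteness comes from
  the bijection with part of a finite chain.\<close>

lemma obtain_maxchain:
  obtains C where "subset.maxchain L C" "finite C" "card C = Suc (card primes)" "finite primes"
proof -
  obtain C where C: "subset.maxchain L C"
    using subset.Hausdorff by blast
  have L: "{V \<in> L. bt \<subseteq> V \<and> V \<subseteq> tp} = L"
    using bt_le le_tp by auto
  have C': "subset.maxchain {V \<in> L. bt \<subseteq> V \<and> V \<subseteq> tp} C"
    unfolding L by (rule C)
  have p: "{P \<in> primes. P \<subseteq> tp \<and> \<not> P \<subseteq> bt} = primes"
    using primes_in le_tp prime_not_le_bt by blast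
  note a = bt_in tp_in bt_le[OF tp_in] C'
  have "finite primes"
    using bij_betw_finite[OF bij_betw_maxchain(1)[OF a]] bij_betw_maxchain(2)[OF a] p by simp
  then show ?thesis
    using that C bij_betw_maxchain(2)[OF a] card_maxchain[OF a] p by simp
qed

lemma finite_primes: "finite primes"
  using obtain_maxchain .

lemma finite_L: "finite L"
proof (rule finite_imageD[OF _ inj_on_below])
  show "finite (below ` L)"
    by (rule finite_subset[of _ "Pow primes"]) (auto simp: below_def finite_primes)
qed

text \<open>Along a chain the sets \<open>below W\<close> are nested, hence distinguished by their
  cardinalities, which range from 0 to the number of primes.\<close>

lemma card_chain_le:
  assumes "subset.chain L C"
  shows "card C \<le> Suc (card primes)"
proof -
  have "inj_on (\<lambda>W. card (below W)) C"
  proof (rule inj_onI)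
    fix W Y assume WY: "W \<in> C" "Y \<in> C" "card (below W) = card (below Y)"
    have fin: "finite (below Z)" for Z
      using finite_primes by (simp add: below_def)
    have "W \<subseteq> Y \<or> Y \<subseteq> W"
      using assms WY by (auto simp: subset_chain_def)
    then have "below W = below Y"
      using below_mono[of W Y] below_mono[of Y W] card_subset_eq[OF fin] WY(3) by metis
    then show "W = Y"
      using inj_onD[OF inj_on_below] assms WY by (auto simp: subset_chain_def)
  qed
  moreover have "(\<lambda>W. card (below W)) ` C \<subseteq> {..card primes}"
    by (auto simp: below_def intro: card_mono finite_primes)
  ultimately have "card C \<le> card {..card primes}"
    by (metis card_inj_on_le finite_atMost)
  then show ?thesis
    by simp
qed

lemma length_eq:
  "(SUP C \<in> {C. subset.chain L C \<and> C \<noteq> {}}. chain_length C) = enat (card primes)"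
proof (rule antisym)
  show "(SUP C \<in> {C. subset.chain L C \<and> C \<noteq> {}}. chain_length C) \<le> enat (card primes)"
  proof (rule SUP_least)
    fix C assume "C \<in> {C. subset.chain L C \<and> C \<noteq> {}}"
    then show "chain_length C \<le> enat (card primes)"
      using card_chain_le[of C] finite_chain[of C] by (simp add: chain_length_def)
  qed
  obtain C where C: "subset.maxchain L C" "finite C" "card C = Suc (card primes)"
    using obtain_maxchain .
  then have "enat (card primes) = chain_length C"
    by (simp add: chain_length_def)
  also have "\<dots> \<le> (SUP C \<in> {C. subset.chain L C \<and> C \<noteq> {}}. chain_length C)"
    using C by (intro SUP_upper) (auto intro: pred_on.maxchain_imp_chain)
  finally show "enat (card primes) \<le> (SUP C \<in> {C. subset.chain L C \<and> C \<noteq> {}}. chain_length C)" .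
qed

section \<open>Atoms, complements and the Boolean case\<close>

text \<open>A minimal element contains some prime, and by minimality equals it.\<close>

lemma minimals_subset_primes: "minimals \<subseteq> primes"
proof
  fix A assume A: "A \<in> minimals"
  then have "A \<in> L" "\<not> A \<subseteq> bt"
    using bt_le by (auto simp: minimals_def)
  then obtain P where "P \<in> primes" "P \<subseteq> A" "\<not> P \<subseteq> bt"
    using ex_prime[of A bt] bt_in by blast
  then show "A \<in> primes"
    using A primes_in[of P] by (auto simp: minimals_def)
qed

lemma minimals_eq_iff_card: "minimals = primes \<longleftrightarrow> card minimals = card primes"
  using minimals_subset_primes finite_primes card_subset_eq by metis

text \<open>A prime inside the join of \<open>F\<close> lies in some member of \<open>F\<close>;
  when that member is minimal, the two coincide. So every set of primes is recovered from its
  join.\<close>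

lemma below_lub:
  assumes "minimals = primes" "F \<subseteq> primes"
  shows "below (lub F) = F"
proof
  have F: "F \<subseteq> L" "finite F"
    using assms primes_in finite_primes finite_subset by auto
  show "F \<subseteq> below (lub F)"
    using lub_upper[OF F(1)] assms(2) by (auto simp: below_def)
  show "below (lub F) \<subseteq> F"
  proof
    fix P assume P: "P \<in> below (lub F)"
    then obtain W where W: "W \<in> F" "P \<subseteq> W"
      using prime_le_lub[of P F] F by (auto simp: below_def)
    have "W \<in> minimals"
      using W(1) assms(2) unfolding assms(1) by blast
    moreover have "P \<in> L" "P \<noteq> bt"
      using P by (auto simp: below_def primes_def)
    ultimately have "P = W"
      using W by (auto simp: minimals_def)
    then show "P \<in> F"
      using W by simp
  qed
qed

lemma complemented_iff: "complemented \<longleftrightarrow> minimals = primes"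
proof
  assume c: complemented
  have "P \<in> minimals" if P: "P \<in> primes" for P
  proof -
    have PL: "P \<in> L" "P \<noteq> bt"
      using P by (auto simp: primes_def)
    have "W = bt" if W: "W \<in> L" "W \<subseteq> P" "W \<noteq> P" for W
    proof -
      obtain Y where Y: "Y \<in> L" "W \<inter> Y = bt" "lub {W, Y} = tp"
        using c W(1) unfolding complemented_def by blast
      \<comment> \<open>\<open>P\<close> is inside the join \<open>tp\<close> of \<open>W\<close>
        and \<open>Y\<close> but not inside \<open>W\<close>. Consequently \<open>W\<close> lies in
        both \<open>P\<close> and \<open>Y\<close>, so it is contained in
        \<open>W \<inter> Y = bt\<close>.\<close>
      have "P \<subseteq> Y"
        using prime_le_lub2[OF P W(1) Y(1)] Y(3) le_tp[OF PL(1)] W by auto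
      then show ?thesis
        using W Y by blast
    qed
    then show ?thesis
      using PL by (auto simp: minimals_def)
  qed
  then show "minimals = primes"
    using minimals_subset_primes by blast
next
  assume m: "minimals = primes"
  show complemented
    unfolding complemented_def
  proof
    fix W assume W: "W \<in> L"
    \<comment> \<open>The complement of \<open>W\<close> is the join of the primes not inside
      \<open>W\<close>.\<close>
    let ?F = "primes - below W"
    let ?Y = "lub ?F"
    have b: "below ?Y = ?F"
      by (rule below_lub[OF m]) auto
    have Y: "?Y \<in> L"
      by (rule lub_in) (auto intro: primes_in)
    have "W \<inter> ?Y \<subseteq> bt"
      using ex_prime[OF inter_in[OF W Y] bt_in] b by (auto simp: below_def)
    then have "W \<inter> ?Y = bt"
      using bt_le[OF inter_in[OF W Y]] by (rule subset_antisym)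
    have v: "lub {W, ?Y} \<in> L" "W \<subseteq> lub {W, ?Y}" "?Y \<subseteq> lub {W, ?Y}"
      using lub_in lub_upper[of "{W, ?Y}"] W Y by auto
    have "tp \<subseteq> lub {W, ?Y}"
    proof -
      have "primes \<subseteq> below (lub {W, ?Y})"
        using below_mono[OF v(2)] below_mono[OF v(3)] b by blast
      then have "below tp \<subseteq> below (lub {W, ?Y})"
        by (auto simp: below_def)
      then show ?thesis
        using below_subset_iff[OF tp_in v(1)] by simp
    qed
    then have "lub {W, ?Y} = tp"
      using le_tp[OF v(1)] by (intro subset_antisym)
    with \<open>W \<inter> ?Y = bt\<close> show "\<exists>Y\<in>L. W \<inter> Y = bt \<and> lub {W, Y} = tp"
      using Y by (intro bexI[of _ ?Y] conjI)
  qed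
qed

text \<open>By injectivity of \<open>below\<close> and finiteness, the cardinality condition says
  that every set of primes has the form \<open>below W\<close>.\<close>

lemma minimals_eq_iff_card_L: "minimals = primes \<longleftrightarrow> card L = 2 ^ card primes"
proof -
  have im: "below ` L \<subseteq> Pow primes"
    by (auto simp: below_def)
  have "card L = 2 ^ card primes \<longleftrightarrow> card (below ` L) = card (Pow primes)"
    using card_image[OF inj_on_below] by (simp add: card_Pow finite_primes)
  also have "\<dots> \<longleftrightarrow> below ` L = Pow primes"
    using card_subset_eq[OF _ im] finite_primes by auto
  also have "\<dots> \<longleftrightarrow> minimals = primes"
  proof
    assume m: "minimals = primes"
    have "F \<in> below ` L" if "F \<subseteq> primes" for F
      using below_lub[OF m that] lub_in[of F] that primes_in by (metis image_eqI subset_eq)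
    then show "below ` L = Pow primes"
      using im by blast
  next
    assume eq: "below ` L = Pow primes"
    have "P \<in> minimals" if P: "P \<in> primes" for P
    proof -
      have "W = bt" if W: "W \<in> L" "W \<subseteq> P" "W \<noteq> P" for W
      proof (rule ccontr)
        assume "W \<noteq> bt"
        then obtain Q where Q: "Q \<in> primes" "Q \<subseteq> W"
          using ex_prime[OF W(1) bt_in] bt_le[OF W(1)] by blast
        \<comment> \<open>Surjectivity yields an element whose only prime is \<open>P\<close>. A
          prime inside the proper part \<open>W\<close> of \<open>P\<close> would be a second
          one.\<close>
        have "{P} \<in> below ` L"
          using P unfolding eq by simp
        then obtain Z where Z: "below Z = {P}"
          by (metis imageE)
        then have "P \<subseteq> Z"
          by (auto simp: below_def)
        then have "Q \<in> below Z"
          using Q W(2) by (auto simp: below_def)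
        then have "Q = P"
          unfolding Z by simp
        then show False
          using Q W by blast
      qed
      then show ?thesis
        using P by (auto simp: minimals_def primes_def)
    qed
    then show "minimals = primes"
      using minimals_subset_primes by blast
  qed
  finally show ?thesis
    by blast
qed

lemma lub_below:
  assumes "W \<in> L"
  shows "lub (below W) = W"
proof (rule subset_antisym)
  have F: "below W \<subseteq> L"
    by (auto simp: below_def primes_in)
  show "lub (below W) \<subseteq> W"
    using assms F by (intro lub_least) (auto simp: below_def)
  have "below W \<subseteq> below (lub (below W))"
    using lub_upper[OF F] by (auto simp: below_def)
  then show "W \<subseteq> lub (below W)"
    using below_subset_iff[OF assms lub_in[OF F]] by simp
qed

text \<open>Since \<open>below (lub F) = F\<close>, the only possible representation of
  \<open>W\<close> is \<open>below W\<close>, and deleting a factor changes the set of primes below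
  the product.\<close>

lemma ex1_irredundant:
  assumes m: "minimals = primes" and W: "W \<in> L"
  shows "\<exists>!F. finite F \<and> F \<subseteq> minimals \<and> lub F = W \<and> (\<forall>A\<in>F. lub (F - {A}) \<noteq> W)"
proof (rule ex1I)
  have sub: "below W \<subseteq> primes"
    by (auto simp: below_def)
  have "lub (below W - {A}) \<noteq> W" if "A \<in> below W" for A
  proof
    assume eq: "lub (below W - {A}) = W"
    have "below (lub (below W - {A})) = below W - {A}"
      by (rule below_lub[OF m]) (use sub in blast)
    then show False
      using that unfolding eq by blast
  qed
  then show "finite (below W) \<and> below W \<subseteq> minimals \<and> lub (below W) = W \<and>
      (\<forall>A\<in>below W. lub (below W - {A}) \<noteq> W)"
    using sub finite_subset[OF sub finite_primes] lub_below[OF W] m by blast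
next
  fix F assume "finite F \<and> F \<subseteq> minimals \<and> lub F = W \<and> (\<forall>A\<in>F. lub (F - {A}) \<noteq> W)"
  then show "F = below W"
    using below_lub[OF m, of F] m by auto
qed

end

section \<open>Simple extensions of commutative rings\<close>

context cring
begin

text \<open>\<^theory>\<open>HOL-Algebra.Finite_Extensions\<close> proves this for domains only.\<close>

lemma simple_extension_is_subring:
  assumes K: "subring K R" and x: "x \<in> carrier R"
  shows "subring (simple_extension K x) R"
proof -
  let ?E = "simple_extension K x"
  have KR: "K \<subseteq> carrier R"
    by (rule subringE(1)[OF K])
  have ER: "a \<in> carrier R" if "a \<in> ?E" for a
    using simple_extension_in_carrier[OF KR x] that by auto
  have KE: "K \<subseteq> ?E"
    by (rule simple_extension_incl[OF KR x])
  \<comment> \<open>\<open>simple_extension\<close> builds polynomials in Horner form, so each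
    closure property is proved by induction on the leading part \<open>k1\<close>.\<close>
  have add: "a \<oplus> b \<in> ?E" if "a \<in> ?E" "b \<in> ?E" for a b
    using that
  proof (induction arbitrary: b rule: simple_extension.induct)
    case zero
    then show ?case
      using ER by simp
  next
    case (lin k1 k2)
    from \<open>b \<in> ?E\<close> show ?case
    proof cases
      case zero
      then show ?thesis
        using simple_extension.lin[OF lin.hyps] ER[OF lin.hyps(1)] lin.hyps(2) KR x by auto
    next
      case (lin l1 l2)
      have c: "k1 \<in> carrier R" "k2 \<in> carrier R" "l1 \<in> carrier R" "l2 \<in> carrier R"
        using ER \<open>k1 \<in> ?E\<close> \<open>k2 \<in> K\<close> lin KR by auto
      have "(k1 \<oplus> l1) \<otimes> x \<oplus> (k2 \<oplus> l2) \<in> ?E"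
        using lin(2,3) \<open>k2 \<in> K\<close> \<open>\<And>b. b \<in> ?E \<Longrightarrow> k1 \<oplus> b \<in> ?E\<close>
        by (intro simple_extension.lin subringE(7)[OF K])
      moreover have "(k1 \<oplus> l1) \<otimes> x \<oplus> (k2 \<oplus> l2) = (k1 \<otimes> x \<oplus> k2) \<oplus> (l1 \<otimes> x \<oplus> l2)"
        using c x by algebra
      ultimately show ?thesis
        using lin(1) by simp
    qed
  qed
  have smult: "k \<otimes> a \<in> ?E" if "a \<in> ?E" "k \<in> K" for a k
    using that(1)
  proof (induction rule: simple_extension.induct)
    case zero
    then show ?case
      using \<open>k \<in> K\<close> KR by auto
  next
    case (lin k1 k2)
    have c: "k1 \<in> carrier R" "k2 \<in> carrier R" "k \<in> carrier R"
      using ER lin \<open>k \<in> K\<close> KR by auto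
    have "(k \<otimes> k1) \<otimes> x \<oplus> k \<otimes> k2 \<in> ?E"
      using lin \<open>k \<in> K\<close> by (intro simple_extension.lin subringE(6)[OF K])
    moreover have "(k \<otimes> k1) \<otimes> x \<oplus> k \<otimes> k2 = k \<otimes> (k1 \<otimes> x \<oplus> k2)"
      using c x by algebra
    ultimately show ?case
      by simp
  qed
  have mult: "a \<otimes> b \<in> ?E" if "a \<in> ?E" "b \<in> ?E" for a b
    using that(1)
  proof (induction rule: simple_extension.induct)
    case zero
    then show ?case
      using ER[OF that(2)] by simp
  next
    case (lin k1 k2)
    have c: "k1 \<in> carrier R" "k2 \<in> carrier R" "b \<in> carrier R"
      using ER lin that KR by auto
    \<comment> \<open>Multiplication by \<open>x\<close> is the Horner step with constant term
      zero.\<close>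
    have "(k1 \<otimes> b) \<otimes> x \<oplus> \<zero> \<in> ?E"
      by (rule simple_extension.lin[OF lin.IH subringE(2)[OF K]])
    then have "((k1 \<otimes> b) \<otimes> x \<oplus> \<zero>) \<oplus> k2 \<otimes> b \<in> ?E"
      by (rule add[OF _ smult[OF that(2)]]) (rule lin.hyps)
    moreover have "((k1 \<otimes> b) \<otimes> x \<oplus> \<zero>) \<oplus> k2 \<otimes> b = (k1 \<otimes> x \<oplus> k2) \<otimes> b"
      using c x by algebra
    ultimately show ?case
      by simp
  qed
  show ?thesis
  proof (rule subringI)
    show "?E \<subseteq> carrier R"
      using ER by blast
    show "\<one> \<in> ?E"
      using subringE(3)[OF K] KE by blast
    fix a b assume a: "a \<in> ?E" and b: "b \<in> ?E"
    have "(\<ominus> \<one>) \<otimes> a \<in> ?E"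
      by (intro smult a subringE(5)[OF K] subringE(3)[OF K])
    then show "\<ominus> a \<in> ?E"
      using ER[OF a] by (simp add: l_minus)
    show "a \<otimes> b \<in> ?E" "a \<oplus> b \<in> ?E"
      using mult add a b by auto
  qed
qed

lemma subring_finsum:
  assumes "subring K R" "finite I" "\<And>i. i \<in> I \<Longrightarrow> f i \<in> K"
  shows "(\<Oplus>i\<in>I. f i) \<in> K"
  using assms(2,3)
proof (induction I rule: finite_induct)
  case empty
  then show ?case
    using subringE(2)[OF assms(1)] by simp
next
  case (insert i I)
  then have "f \<in> I \<rightarrow> carrier R" "f i \<in> carrier R"
    using subringE(1)[OF assms(1)] by auto
  then show ?case
    using insert subringE(7)[OF assms(1)] by auto
qed

end

section \<open>Ring extensions\<close>

lemma distributive_fcp_lattice_extensions: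
  assumes "cring S" and R: "subring R S" and "has_FCP S R" and dist: "distributive_ext S R"
  shows "distributive_fcp_lattice (extensions S R) R (carrier S) (family_product S R)"
proof -
  interpret S: cring S by fact
  have RS: "R \<subseteq> carrier S"
    by (rule subringE(1)[OF R])
  \<comment> \<open>Both factors contain \<open>R\<close>, so adjoining \<open>R\<close> to the
    generators changes nothing.\<close>
  have comp: "family_product S R {U, V} = compositum S U V"
    if "U \<in> extensions S R" "V \<in> extensions S R" for U V
  proof -
    have "R \<union> \<Union>{U, V} = U \<union> V"
      using that by (auto simp: interval_def)
    then show ?thesis
      by (simp add: family_product_def compositum_def)
  qed
  have un: "R \<union> \<Union>F \<subseteq> carrier S" if "F \<subseteq> extensions S R" for F
    using that RS by (auto simp: interval_def)
  have inter: "W \<inter> Y \<in> extensions S R" if "W \<in> extensions S R" "Y \<in> extensions S R" for W Y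
    using that S.subring_inter by (auto simp: interval_def)
  show ?thesis
  proof
    show "R \<in> extensions S R" "carrier S \<in> extensions S R"
      using R RS S.carrier_is_subring by (auto simp: interval_def)
    show "R \<subseteq> W" "W \<subseteq> carrier S" if "W \<in> extensions S R" for W
      using that by (auto simp: interval_def)
    show "W \<inter> Y \<in> extensions S R" if "W \<in> extensions S R" "Y \<in> extensions S R" for W Y
      using inter that .
    show "family_product S R F \<in> extensions S R" if "F \<subseteq> extensions S R" for F
      using S.generate_ring_is_subring[OF un[OF that]] S.generate_ringE(2)[OF un[OF that] refl]
        S.generate_ring_incl[OF un[OF that]]
      by (auto simp: interval_def family_product_def)
    show "W \<subseteq> family_product S R F" if "F \<subseteq> extensions S R" "W \<in> F" for F W
      using S.generate_ringE(2)[OF un[OF that(1)] refl] that(2)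
      by (auto simp: family_product_def)
    show "family_product S R F \<subseteq> Y"
      if "F \<subseteq> extensions S R" "Y \<in> extensions S R" "\<And>W. W \<in> F \<Longrightarrow> W \<subseteq> Y" for F Y
      unfolding family_product_def
    proof (rule S.generate_ring_min_subring1[OF un[OF that(1)]])
      show "subring Y S"
        using that(2) by (simp add: interval_def)
      show "R \<union> \<Union>F \<subseteq> Y"
        using that(2,3) by (simp add: interval_def Sup_le_iff)
    qed
    show "W \<inter> family_product S R {U, V} = family_product S R {W \<inter> U, W \<inter> V}"
      if "W \<in> extensions S R" "U \<in> extensions S R" "V \<in> extensions S R" for W U V
      using dist that by (simp add: comp inter distributive_ext_def)
    show "finite C" if "subset.chain (extensions S R) C" for C
      using that assms(3) by (simp add: has_FCP_def)
  qed
qed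

theorem theorem3p1:
  fixes S :: "('a, 'b) ring_scheme" and R :: "'a set"
  assumes "cring S" and "subring R S"
    and "has_FCP S R" and "distributive_ext S R"
  shows "(\<exists>n::nat. ext_length S R = enat n
            \<and> (boolean_ext S R \<longleftrightarrow> finite (atoms S R) \<and> n = card (atoms S R))
            \<and> (boolean_ext S R \<longleftrightarrow> finite (extensions S R) \<and> card (extensions S R) = 2 ^ n))
       \<and> (boolean_ext S R \<longrightarrow> has_FIP S R \<and> factorial_ext S R \<and> simple_pair S R)
       \<and> (\<forall>T \<in> extensions S R. \<forall>U \<in> extensions S R. T \<subseteq> U \<longrightarrow>
            (\<forall>C D. subset.maxchain (interval S T U) C \<and> subset.maxchain (interval S T U) D
               \<longrightarrow> chain_length C = chain_length D))"
proof -
  interpret S: cring S by fact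
  interpret E: distributive_fcp_lattice "extensions S R" R "carrier S" "family_product S R"
    using distributive_fcp_lattice_extensions[OF assms] .
  have atoms: "atoms S R = E.minimals"
  proof -
    have "interval S R T = {R, T} \<longleftrightarrow> (\<forall>W\<in>extensions S R. W \<subseteq> T \<longrightarrow> W = R \<or> W = T)"
      if "T \<in> extensions S R" for T
    proof -
      have "interval S R T = {W \<in> extensions S R. W \<subseteq> T}" "R \<in> extensions S R" "R \<subseteq> T"
        using that assms(2) by (auto simp: interval_def)
      then show ?thesis
        using that by blast
    qed
    then show ?thesis
      by (auto simp: atoms_def E.minimals_def)
  qed
  have bool: "boolean_ext S R \<longleftrightarrow> E.minimals = E.primes"
  proof -
    have "compositum S T U = family_product S R {T, U}" if "T \<in> extensions S R" for T U
    proof -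
      have "R \<union> \<Union>{T, U} = T \<union> U"
        using that by (auto simp: interval_def)
      then show ?thesis
        by (simp add: family_product_def compositum_def)
    qed
    then show ?thesis
      using assms(4)
      by (auto simp: boolean_ext_def E.complemented_iff[symmetric] E.complemented_def)
  qed
  have finite_atoms: "finite (atoms S R)"
    using finite_subset[OF E.minimals_subset_primes E.finite_primes] by (simp add: atoms)
  have len: "ext_length S R = enat (card E.primes)"
    unfolding ext_length_def by (rule E.length_eq)
  have two: "boolean_ext S R \<longleftrightarrow> finite (atoms S R) \<and> card E.primes = card (atoms S R)"
    using finite_atoms E.minimals_eq_iff_card bool unfolding atoms by metis
  have three: "boolean_ext S R \<longleftrightarrow>
      finite (extensions S R) \<and> card (extensions S R) = 2 ^ card E.primes"
    using E.finite_L E.minimals_eq_iff_card_L bool by blast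
  have fact: "factorial_ext S R" if "boolean_ext S R"
    using E.ex1_irredundant that
    by (simp add: factorial_ext_def irredundant_rep_def atoms bool)
  have simple: "simple_pair S R" if b: "boolean_ext S R"
    unfolding simple_pair_def
  proof
    fix T assume T: "T \<in> extensions S R"
    have m: "E.minimals = E.primes"
      using b bool by simp
    have sub: "V \<in> extensions S R \<Longrightarrow> subring V S" for V
      by (simp add: interval_def)
    let ?A = "E.below T"
    have A: "finite ?A" "?A \<subseteq> E.primes"
      using finite_subset[OF _ E.finite_primes] by (auto simp: E.below_def)
    \<comment> \<open>A prime is not inside \<open>R\<close>; one element outside \<open>R\<close>
      is chosen from each.\<close>
    have "\<exists>x. x \<in> P - R" if "P \<in> E.primes" for P
      using E.prime_not_le_bt[OF that] by blast
    then obtain x where x: "\<And>P. P \<in> E.primes \<Longrightarrow> x P \<in> P - R"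
      by metis
    define t where "t = (\<Oplus>\<^bsub>S\<^esub>P\<in>?A. x P)"
    have tT: "t \<in> T"
      unfolding t_def using A x by (intro S.subring_finsum[OF sub[OF T]]) (auto simp: E.below_def)
    then have tS: "t \<in> carrier S"
      using subringE(1)[OF sub[OF T]] by blast
    let ?V = "S.simple_extension R t"
    have VT: "?V \<subseteq> T"
      using S.simple_extension_subring_incl[OF sub[OF T] _ tT] T by (auto simp: interval_def)
    have V: "?V \<in> extensions S R"
      using S.simple_extension_is_subring[OF assms(2) tS]
        S.simple_extension_incl[OF subringE(1)[OF assms(2)] tS]
        subringE(1)[OF S.simple_extension_is_subring[OF assms(2) tS]]
      by (simp add: interval_def)
    have "?A \<subseteq> E.below ?V"
    proof (rule ccontr)
      assume "\<not> ?A \<subseteq> E.below ?V"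
      then obtain Q where Q: "Q \<in> ?A" "Q \<notin> E.below ?V"
        by blast
      let ?B = "family_product S R (?A - {Q})"
      have F: "?A - {Q} \<subseteq> extensions S R"
        using A E.primes_in by blast
      have B: "?B \<in> extensions S R"
        by (rule E.lub_in[OF F])
      have bB: "E.below ?B = ?A - {Q}"
        using A by (intro E.below_lub[OF m]) auto
      \<comment> \<open>All primes inside \<open>?V\<close> are inside \<open>T\<close> and differ
        from \<open>Q\<close>, so they are factors of \<open>?B\<close>.\<close>
      have "E.below ?V \<subseteq> E.below ?B"
        using E.below_mono[OF VT] Q bB by blast
      then have "?V \<subseteq> ?B"
        using E.below_subset_iff[OF V B] by simp
      then have tB: "t \<in> ?B"
        using S.simple_extension_mem[OF assms(2) tS] by blast
      have QL: "Q \<in> E.primes" "Q \<in> extensions S R"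
        using Q A E.primes_in by auto
      have xB: "x P \<in> ?B" if "P \<in> ?A - {Q}" for P
        using E.lub_upper[OF F that] x[of P] A that by blast
      let ?s = "\<Oplus>\<^bsub>S\<^esub>P\<in>?A - {Q}. x P"
      have sB: "?s \<in> ?B"
        using A xB by (intro S.subring_finsum[OF sub[OF B]]) auto
      have xS: "x P \<in> carrier S" if "P \<in> ?A" for P
        using x[of P] A that subringE(1)[OF sub[OF E.primes_in]] by blast
      have sS: "?s \<in> carrier S"
        using sB subringE(1)[OF sub[OF B]] by blast
      have "t = (\<Oplus>\<^bsub>S\<^esub>P\<in>insert Q (?A - {Q}). x P)"
        using Q by (simp add: t_def insert_absorb)
      also have "\<dots> = x Q \<oplus>\<^bsub>S\<^esub> ?s"
        using A xS Q by (intro S.finsum_insert) auto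
      finally have "t = x Q \<oplus>\<^bsub>S\<^esub> ?s" .
      then have "x Q = t \<oplus>\<^bsub>S\<^esub> (\<ominus>\<^bsub>S\<^esub> ?s)"
        using xS[OF Q(1)] sS by algebra
      then have "x Q \<in> ?B"
        using subringE(5,7)[OF sub[OF B]] tB sB by simp
      \<comment> \<open>\<open>Q\<close> is an atom not contained in \<open>?B\<close>, so the two
        meet only in \<open>R\<close>. This contradicts the choice of \<open>x Q\<close> outside
        \<open>R\<close>.\<close>
      moreover have "Q \<inter> ?B = R"
      proof -
        have "\<not> Q \<subseteq> ?B"
          using bB QL by (auto simp: E.below_def)
        moreover have "Q \<inter> ?B \<in> extensions S R"
          using E.inter_in QL B by blast
        moreover have "Q \<in> E.minimals"
          unfolding m by (rule QL(1))
        then have "\<And>W. W \<in> extensions S R \<Longrightarrow> W \<subseteq> Q \<Longrightarrow> W = R \<or> W = Q"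
          by (simp add: E.minimals_def)
        ultimately show ?thesis
          by (metis Int_lower1 inf.absorb_iff1)
      qed
      ultimately show False
        using x[OF QL(1)] by blast
    qed
    then have "T \<subseteq> ?V"
      using E.below_subset_iff[OF T V] by simp
    then show "\<exists>t\<in>T. T = S.simple_extension R t"
      using VT tT by blast
  qed
  have chains: "chain_length C = chain_length D"
    if TU: "T \<in> extensions S R" "U \<in> extensions S R" "T \<subseteq> U"
      and CD: "subset.maxchain (interval S T U) C" "subset.maxchain (interval S T U) D"
    for T U C D
  proof -
    have I: "interval S T U = {V \<in> extensions S R. T \<subseteq> V \<and> V \<subseteq> U}"
      using TU by (auto simp: interval_def)
    show ?thesis
      using E.card_maxchain[OF TU] E.bij_betw_maxchain(2)[OF TU] CD
      by (simp add: I chain_length_def)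
  qed
  show ?thesis
    using len two three fact simple chains E.finite_L by (auto simp: has_FIP_def)
qed

end
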